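(* (Varying stepsize.) Let $A$ and $B$ be maximally monotone operators from $\mathbb{R}^p$ to $2^{\mathbb{R}^p}$ with $B$ single-valued, let $\gamma>0$, and let $G_\gamma(x):=\gamma^{-1}\big(x-J_{\gamma A}(x-\gamma B(x))\big)$. Let $x^\star$ satisfy $0\in A(x^\star)+B(x^\star)$ (such a point is assumed to exist). Given $u_0\in\mathbb{R}^p$, let $x_0:=J_{\gamma B}(u_0)$ (so $u_0=x_0+\gamma B(x_0)$), and for $k\ge0$ $$u_{k+1}:=u_k+\beta_k(u_0-u_k)-\eta_kG_\gamma(x_k),\qquad x_{k+1}:=J_{\gamma B}(u_{k+1}),$$ where $$\beta_k:=\frac1{k+2},\qquad \eta_0\in(0,\gamma),\qquad \eta_{k+1}:=\frac{\beta_{k+1}\left[2\gamma(1-\beta_k^2)-\eta_k\right]\eta_k}{\beta_k(1-\beta_k)(2\gamma-\eta_k)}.$$ Then, for all $k\geq 0$, $$\|G_\gamma(x_k)\|^2\le\frac{4}{\eta_*(k+1)(k+2)}\left(\eta_0\|G_\gamma(x_0)\|^2+\frac1{\eta_*}\|x^\star+\gamma B(x^\star)-u_0\|^2\right),$$ where $\eta_*:=\lim_{k\to\infty}\eta_k>\frac{2\eta_0(\gamma-\eta_0)}{2\gamma-\eta_0}>0$. If, additionally, $B$ is $L$-Lipschitz continuous, then $$\|G_\gamma(x_k)\|^2\le\frac{4(1+\gamma L)^2(\eta_0\eta_*+\gamma^2)}{\eta_*^2\gamma^2(k+1)(k+2)}\|x_0-x^\star\|^2.$$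
   Context: $\mathbb{R}^p$ carries the standard inner product and Euclidean norm $\|\cdot\|$. For a maximally monotone operator $T$ and $\gamma>0$, $J_{\gamma T}:=(\mathbb{I}+\gamma T)^{-1}$ is its resolvent, single-valued and defined on all of $\mathbb{R}^p$. The iteration is equivalently (since $\gamma B(x_k)=u_k-x_k$): $x_k=J_{\gamma B}(u_k)$, $v_k=J_{\gamma A}(2x_k-u_k)$, $u_{k+1}=\beta_ku_0+(1-\beta_k)u_k+\frac{\eta_k}{\gamma}(v_k-x_k)$. *)

theory Defs
  imports "HOL-Analysis.Analysis" "HOL-Library.Set_Algebras"
begin

text \<open>A set-valued operator is a function into sets; its domain consists of the points with
  nonempty image.\<close>

definition op_dom :: "('a \<Rightarrow> 'b set) \<Rightarrow> 'a set" where
  "op_dom T = {x. T x \<noteq> {}}"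

text \<open>Single-valuedness does not include totality: it only forbids two different values at
  the same point.\<close>

definition single_valued_op :: "('a \<Rightarrow> 'b set) \<Rightarrow> bool" where
  "single_valued_op T \<longleftrightarrow> (\<forall>x. \<forall>u\<in>T x. \<forall>v\<in>T x. u = v)"

text \<open>The value is meaningful only where the image is a singleton.\<close>

definition op_val :: "('a \<Rightarrow> 'b set) \<Rightarrow> 'a \<Rightarrow> 'b" where
  "op_val T x = the_elem (T x)"

definition op_inverse :: "('a \<Rightarrow> 'b set) \<Rightarrow> 'b \<Rightarrow> 'a set" where
  "op_inverse T u = {x. u \<in> T x}"

definition monotone_op :: "('a::real_inner \<Rightarrow> 'a set) \<Rightarrow> bool" where
  "monotone_op T \<longleftrightarrow> (\<forall>x y. \<forall>u\<in>T x. \<forall>v\<in>T y. (u - v) \<bullet> (x - y) \<ge> 0)"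

definition maximally_monotone :: "('a::real_inner \<Rightarrow> 'a set) \<Rightarrow> bool" where
  "maximally_monotone T \<longleftrightarrow>
     monotone_op T \<and> (\<forall>S. monotone_op S \<and> (\<forall>x. T x \<subseteq> S x) \<longrightarrow> S = T)"

text \<open>The resolvent \<open>(I + \<gamma> T)\<^sup>-\<^sup>1\<close> is read as a point map. For maximally monotone \<open>T\<close>
  and \<open>\<gamma> > 0\<close> the inverse is everywhere a singleton (Minty), so the value is the intended one.\<close>

definition resolvent :: "real \<Rightarrow> ('a::real_inner \<Rightarrow> 'a set) \<Rightarrow> 'a \<Rightarrow> 'a" where
  "resolvent \<gamma> T = op_val (op_inverse (\<lambda>x. {x + \<gamma> *\<^sub>R y | y. y \<in> T x}))"

text \<open>The forward-backward residual mapping; \<open>B\<close> is evaluated as a single-valued operator, so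
  this is meaningful for \<open>x\<close> in the domain of \<open>B\<close>.\<close>

definition fb_residual ::
  "real \<Rightarrow> ('a::real_inner \<Rightarrow> 'a set) \<Rightarrow> ('a \<Rightarrow> 'a set) \<Rightarrow> 'a \<Rightarrow> 'a" where
  "fb_residual \<gamma> A B x = (1 / \<gamma>) *\<^sub>R (x - resolvent \<gamma> A (x - \<gamma> *\<^sub>R op_val B x))"

end

theory Submission imports Defs begin

text \<open>With \<open>F u = G\<^sub>\<gamma> (J\<^sub>\<gamma>\<^sub>B u)\<close> the scheme is a Halpern iteration for the \<open>\<gamma>\<close>-cocoercive
  map \<open>F\<close> (the Douglas--Rachford residual), which vanishes at \<open>x\<^sup>\<star> + \<gamma> B x\<^sup>\<star>\<close>. The stepsize rule is
  exactly what makes the decrease of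
  \<open>V\<^sub>k = (k+1)(k+2)\<eta>\<^sub>k/2 \<parallel>F u\<^sub>k\<parallel>\<^sup>2 + (k+1) \<langle>F u\<^sub>k, u\<^sub>k - u\<^sub>0\<rangle>\<close> a perfect square.
  Since \<open>\<beta>\<^sub>k\<^sub>+\<^sub>1 / (\<beta>\<^sub>k (1 - \<beta>\<^sub>k)) = 1 / (1 - \<beta>\<^sub>k\<^sup>2)\<close>, the rule reads
  \<open>\<eta>\<^sub>k\<^sub>+\<^sub>1 = \<eta>\<^sub>k - \<eta>\<^sub>k\<^sup>2 / ((2\<gamma> - \<eta>\<^sub>k)(k+1)(k+3))\<close>, and the telescoping sum
  \<open>\<Sum> 1/((k+1)(k+3)) = 3/4\<close> bounds the limit from below.
  That resolvents are everywhere defined (Minty) is reduced by compactness to a finite family of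
  balls; a common point is read off from the maximum of a concave quadratic over a convex hull.\<close>

section \<open>Minty's theorem\<close>

text \<open>Completing the square at the midpoint (Thales): the segment from \<open>a\<close> to
  \<open>y\<close> is seen under a right or obtuse angle exactly inside the ball on that diameter.
  This makes compactness available.\<close>

lemma inner_le_0_iff_cball:
  fixes a y x :: "'a::real_inner"
  shows "(x - a) \<bullet> (x - y) \<le> 0 \<longleftrightarrow> x \<in> cball ((1/2) *\<^sub>R (a + y)) (norm (a - y) / 2)"
proof -
  have "(norm (x - (1/2) *\<^sub>R (a + y)))\<^sup>2 - (norm (a - y) / 2)\<^sup>2 = (x - a) \<bullet> (x - y)"
    by (simp add: power_divide power2_norm_eq_inner algebra_simps inner_commute
        add_divide_distrib diff_divide_distrib)
  moreover have "norm (x - (1/2) *\<^sub>R (a + y)) \<le> norm (a - y) / 2 \<longleftrightarrow>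
      (norm (x - (1/2) *\<^sub>R (a + y)))\<^sup>2 \<le> (norm (a - y) / 2)\<^sup>2"
    by (simp add: power2_le_iff_abs_le)
  ultimately have "(x - a) \<bullet> (x - y) \<le> 0 \<longleftrightarrow> norm (x - (1/2) *\<^sub>R (a + y)) \<le> norm (a - y) / 2"
    by linarith
  then show ?thesis
    unfolding mem_cball dist_norm norm_minus_commute[of x] .
qed

text \<open>With weights w_i, the difference s - a.y is half the sum of w_i w_j (a_i - a_j).(y_i -
  y_j), hence at most 0. The double sum is replaced by two hull arguments, one per index.\<close>

lemma antimonotone_hull_inner_le:
  fixes Q :: "('a::real_inner \<times> 'a) set"
  assumes anti: "\<And>a y b z. (a, y) \<in> Q \<Longrightarrow> (b, z) \<in> Q \<Longrightarrow> (a - b) \<bullet> (y - z) \<le> 0"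
    and mem: "(a, y, s) \<in> convex hull ((\<lambda>(a, y). (a, y, a \<bullet> y)) ` Q)"
  shows "s \<le> a \<bullet> y"
proof -
  let ?P = "(\<lambda>(a, y). (a, y, a \<bullet> y)) ` Q"
  \<comment> \<open>The defining inequality is symmetric in \<open>(a, y, s)\<close> and
    \<open>(b, z, r)\<close> and affine in each, so every \<open>H b z r\<close> is a half-space and
    the two triples may swap roles.\<close>
  define H where "H b z r = {(a, y, s). s - a \<bullet> z - b \<bullet> y + r \<le> 0}" for b z :: 'a and r :: real
  have convH: "convex (H b z r)" for b z r
  proof (rule convexI)
    fix p q :: "'a \<times> 'a \<times> real" and v w :: real
    assume p: "p \<in> H b z r" and q: "q \<in> H b z r" and vw: "0 \<le> v" "0 \<le> w" "v + w = 1"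
    obtain a1 y1 s1 a2 y2 s2 where pq: "p = (a1, y1, s1)" "q = (a2, y2, s2)"
      by (metis prod.exhaust)
    have "v * (s1 - a1 \<bullet> z - b \<bullet> y1 + r) + w * (s2 - a2 \<bullet> z - b \<bullet> y2 + r) \<le> 0"
      using p q vw by (auto simp: pq H_def intro!: add_nonpos_nonpos mult_nonneg_nonpos)
    moreover have "r = v * r + w * r"
      using vw(3) by (metis distrib_right mult_1)
    ultimately show "v *\<^sub>R p + w *\<^sub>R q \<in> H b z r"
      by (simp add: pq H_def inner_add_left inner_add_right algebra_simps)
  qed
  have 1: "convex hull ?P \<subseteq> H b z (b \<bullet> z)" if "(b, z) \<in> Q" for b z
  proof (intro hull_minimal convH subsetI)
    fix p assume "p \<in> ?P"
    then obtain a y where "p = (a, y, a \<bullet> y)" "(a, y) \<in> Q" by auto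
    then show "p \<in> H b z (b \<bullet> z)"
      using anti[OF _ that, of a y] by (simp add: H_def algebra_simps)
  qed
  \<comment> \<open>Now the hull point is fixed and the generator varies; evaluating this inclusion
    at \<open>(a, y, s)\<close> itself gives 2s <= 2 a.y.\<close>
  have "convex hull ?P \<subseteq> H a y s"
  proof (intro hull_minimal convH subsetI)
    fix p assume "p \<in> ?P"
    then obtain b z where "p = (b, z, b \<bullet> z)" "(b, z) \<in> Q" by auto
    then show "p \<in> H a y s"
      using 1[of b z] mem by (auto simp: H_def)
  qed
  then show ?thesis
    using mem by (auto simp: H_def)
qed

text \<open>Minimax duality: averaging the functions (x - a).(x - y) over \<open>Q\<close> gives
  |x|^2 - x.(a + y) + s, whose minimum over x is \<open>?f\<close>, attained at the midpoint of
  \<open>a\<close> and \<open>y\<close>. The midpoint for a maximiser of \<open>?f\<close> is the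
  common point, because the preceding lemma makes the maximum nonpositive.\<close>

lemma antimonotone_finite_common_point:
  fixes Q :: "('a::euclidean_space \<times> 'a) set"
  assumes anti: "\<And>a y b z. (a, y) \<in> Q \<Longrightarrow> (b, z) \<in> Q \<Longrightarrow> (a - b) \<bullet> (y - z) \<le> 0"
    and "finite Q" "Q \<noteq> {}"
  shows "\<exists>x. \<forall>(a, y)\<in>Q. (x - a) \<bullet> (x - y) \<le> 0"
proof -
  let ?P = "(\<lambda>(a, y). (a, y, a \<bullet> y)) ` Q"
  let ?f = "\<lambda>p :: 'a \<times> 'a \<times> real.
    snd (snd p) - (norm ((1/2) *\<^sub>R (fst p + fst (snd p))))\<^sup>2"
  have "compact (convex hull ?P)" "convex hull ?P \<noteq> {}"
    using assms by (simp_all add: finite_imp_compact_convex_hull)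
  moreover have "continuous_on (convex hull ?P) ?f"
    by (intro continuous_intros)
  ultimately obtain p where p: "p \<in> convex hull ?P"
    and max: "\<And>q. q \<in> convex hull ?P \<Longrightarrow> ?f q \<le> ?f p"
    using continuous_attains_sup[of "convex hull ?P" ?f] by blast
  obtain a y s where pe: "p = (a, y, s)" by (metis prod.exhaust)
  define c where "c = (1/2) *\<^sub>R (a + y)"
  have "s \<le> a \<bullet> y"
    using antimonotone_hull_inner_le[OF anti] p unfolding pe by blast
  moreover have "(norm c)\<^sup>2 - a \<bullet> y = (norm ((1/2) *\<^sub>R (a - y)))\<^sup>2"
    unfolding c_def power2_norm_eq_inner by (simp add: algebra_simps inner_commute)
  ultimately have val: "s \<le> (norm c)\<^sup>2"
    by (smt (verit) zero_le_power2)
  have "(c - b) \<bullet> (c - z) \<le> 0" if bz: "(b, z) \<in> Q" for b z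
  proof -
    define e where "e = (1/2) *\<^sub>R (b + z) - c"
    define D where "D = b \<bullet> z - s - 2 * (c \<bullet> e)"
    \<comment> \<open>\<open>D\<close> is the slope of \<open>?f\<close> at the maximiser
      \<open>p\<close> towards the generator \<open>(b, z, b \<bullet> z)\<close>. Maximality along
      this segment, divided by \<open>t\<close>, gives the bound; letting \<open>t\<close> tend to 0
      then shows \<open>D \<le> 0\<close>.\<close>
    have ineq: "D \<le> t * (norm e)\<^sup>2" if t: "0 < t" "t \<le> 1" for t :: real
    proof -
      have "(1 - t) *\<^sub>R p + t *\<^sub>R (b, z, b \<bullet> z) \<in> convex hull ?P"
        using t bz p by (intro convexD[OF convex_convex_hull]) (auto intro!: hull_inc)
      from max[OF this]
      have le: "(1 - t) * s + t * (b \<bullet> z)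
          - (norm ((1/2) *\<^sub>R ((1 - t) *\<^sub>R a + t *\<^sub>R b + ((1 - t) *\<^sub>R y + t *\<^sub>R z))))\<^sup>2
        \<le> s - (norm c)\<^sup>2"
        by (simp add: pe c_def)
      have eq: "(1/2) *\<^sub>R ((1 - t) *\<^sub>R a + t *\<^sub>R b + ((1 - t) *\<^sub>R y + t *\<^sub>R z)) = c + t *\<^sub>R e"
        by (simp add: c_def e_def algebra_simps)
      have "t * D \<le> t * (t * (norm e)\<^sup>2)"
        using le unfolding eq
        by (simp add: D_def power2_norm_eq_inner algebra_simps inner_commute)
      then show ?thesis using t by simp
    qed
    have "((\<lambda>t. t * (norm e)\<^sup>2) \<longlongrightarrow> 0 * (norm e)\<^sup>2) (at_right (0::real))"
      by (intro tendsto_intros)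
    moreover have "eventually (\<lambda>t. D \<le> t * (norm e)\<^sup>2) (at_right (0::real))"
      unfolding eventually_at_right_field using ineq by (intro exI[of _ 1]) auto
    ultimately have "D \<le> 0"
      using tendsto_lowerbound by fastforce
    moreover have "(c - b) \<bullet> (c - z) = D + (s - (norm c)\<^sup>2)"
      by (simp add: D_def e_def power2_norm_eq_inner algebra_simps inner_commute)
    ultimately show ?thesis using val by linarith
  qed
  then show ?thesis by auto
qed

lemma antimonotone_common_point:
  fixes Q :: "('a::euclidean_space \<times> 'a) set"
  assumes anti: "\<And>a y b z. (a, y) \<in> Q \<Longrightarrow> (b, z) \<in> Q \<Longrightarrow> (a - b) \<bullet> (y - z) \<le> 0"
  shows "\<exists>x. \<forall>(a, y)\<in>Q. (x - a) \<bullet> (x - y) \<le> 0"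
proof (cases "Q = {}")
  case False
  then obtain q where q: "q \<in> Q" by blast
  let ?C = "\<lambda>(a, y). cball ((1/2) *\<^sub>R (a + y :: 'a)) (norm (a - y) / 2)"
  have "?C q \<inter> \<Inter> (?C ` Q) \<noteq> {}"
  proof (rule compact_imp_fip)
    show "compact (?C q)" by (simp split: prod.split)
    show "closed T" if "T \<in> ?C ` Q" for T
      using that by auto
    fix F assume F: "finite F" "F \<subseteq> ?C ` Q"
    then obtain R where R: "R \<subseteq> Q" "finite R" "F = ?C ` R"
      by (meson finite_subset_image)
    \<comment> \<open>Inserting \<open>q\<close> puts the common point into the compact ball
      \<open>?C q\<close> and keeps the finite family nonempty.\<close>
    have "\<exists>x. \<forall>(a, y)\<in>insert q R. (x - a) \<bullet> (x - y) \<le> 0"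
    proof (rule antimonotone_finite_common_point)
      show "(a - b) \<bullet> (y - z) \<le> 0" if "(a, y) \<in> insert q R" "(b, z) \<in> insert q R" for a y b z
        using that R(1) q by (intro anti) auto
    qed (use R(2) in auto)
    then show "?C q \<inter> \<Inter> F \<noteq> {}"
      unfolding R(3) inner_le_0_iff_cball by (auto simp del: mem_cball)
  qed
  then obtain x where "\<And>p. p \<in> Q \<Longrightarrow> x \<in> ?C p" by auto
  then have "\<forall>(a, y)\<in>Q. (x - a) \<bullet> (x - y) \<le> 0"
    unfolding inner_le_0_iff_cball by fast
  then show ?thesis ..
qed simp

section \<open>Maximality and resolvents\<close>

lemma maximally_monotone_mem:
  assumes T: "maximally_monotone T"
    and rel: "\<And>y v. v \<in> T y \<Longrightarrow> (v - w) \<bullet> (y - x) \<ge> 0"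
  shows "w \<in> T x"
proof -
  \<comment> \<open>Adjoining the single graph point \<open>(x, w)\<close> preserves monotonicity,
    so by maximality it already belongs to \<open>T\<close>.\<close>
  define S where "S = (\<lambda>z. T z \<union> {v. z = x \<and> v = w})"
  have mono: "monotone_op T" using T by (simp add: maximally_monotone_def)
  have rel': "(w - v) \<bullet> (x - y) \<ge> 0" if "v \<in> T y" for y v
    using rel[OF that] by (simp add: algebra_simps)
  have "monotone_op S"
    using mono rel rel' unfolding monotone_op_def S_def by auto
  then have "S = T"
    using T by (simp add: maximally_monotone_def S_def)
  moreover have "w \<in> S x" by (simp add: S_def)
  ultimately show ?thesis by simp
qed

text \<open>Monotonicity makes I + \<gamma> T injective, so the inverse image is a singleton, where
  \<open>op_val\<close> is meaningful.\<close>

lemma resolvent_eqI: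
  assumes "monotone_op T" "\<gamma> > 0" "y \<in> T x"
  shows "resolvent \<gamma> T (x + \<gamma> *\<^sub>R y) = x"
proof -
  have "z = x" if eq: "x + \<gamma> *\<^sub>R y = z + \<gamma> *\<^sub>R v" and v: "v \<in> T z" for z v
  proof -
    have "(y - v) \<bullet> (x - z) \<ge> 0"
      using assms v by (simp add: monotone_op_def)
    then have "\<gamma> *\<^sub>R (y - v) \<bullet> (x - z) \<ge> 0"
      using \<open>\<gamma> > 0\<close> by simp
    moreover have "\<gamma> *\<^sub>R (y - v) = - (x - z)"
      using eq by (simp add: algebra_simps)
    ultimately have "(x - z) \<bullet> (x - z) \<le> 0"
      by (metis inner_minus_left neg_0_le_iff_le)
    then show ?thesis by (metis eq_iff_diff_eq_0 inner_gt_zero_iff linorder_not_le)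
  qed
  then have "op_inverse (\<lambda>x. {x + \<gamma> *\<^sub>R y | y. y \<in> T x}) (x + \<gamma> *\<^sub>R y) = {x}"
    using assms(3) by (auto simp: op_inverse_def)
  then show ?thesis by (simp add: resolvent_def op_val_def)
qed

text \<open>Stated as graph membership because this is the form in which monotonicity is later
  applied at resolvent values.\<close>

theorem minty:
  fixes T :: "'a::euclidean_space \<Rightarrow> 'a set"
  assumes T: "maximally_monotone T" and g: "\<gamma> > 0"
  shows "(1 / \<gamma>) *\<^sub>R (w - resolvent \<gamma> T w) \<in> T (resolvent \<gamma> T w)"
proof -
  have mono: "monotone_op T" using T by (simp add: maximally_monotone_def)
  \<comment> \<open>For \<open>v \<in> T y\<close>, the inequality sought at \<open>x\<close> says,
    up to a factor -\<gamma>, that (x, (w - x)/\<gamma>) is monotonically related to (y, v). The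
    sign in front of \<open>v\<close> turns monotonicity of \<open>T\<close> into antimonotonicity
    of \<open>Q\<close>.\<close>
  define Q where "Q = {(w - \<gamma> *\<^sub>R v, y) | v y. v \<in> T y}"
  have "\<exists>x. \<forall>(a, y)\<in>Q. (x - a) \<bullet> (x - y) \<le> 0"
  proof (rule antimonotone_common_point)
    fix a y b z assume "(a, y) \<in> Q" "(b, z) \<in> Q"
    then obtain v v' where v: "a = w - \<gamma> *\<^sub>R v" "v \<in> T y" "b = w - \<gamma> *\<^sub>R v'" "v' \<in> T z"
      by (auto simp: Q_def)
    have "a - b = - (\<gamma> *\<^sub>R (v - v'))" by (simp add: v algebra_simps)
    then have "(a - b) \<bullet> (y - z) = - (\<gamma> * ((v - v') \<bullet> (y - z)))" by simp
    moreover have "(v - v') \<bullet> (y - z) \<ge> 0"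
      using mono v by (simp add: monotone_op_def)
    ultimately show "(a - b) \<bullet> (y - z) \<le> 0" using g by simp
  qed
  then obtain x where x: "\<And>y v. v \<in> T y \<Longrightarrow> (x - (w - \<gamma> *\<^sub>R v)) \<bullet> (x - y) \<le> 0"
    by (fastforce simp: Q_def)
  have mem: "(1 / \<gamma>) *\<^sub>R (w - x) \<in> T x"
  proof (rule maximally_monotone_mem[OF T])
    fix y v assume "v \<in> T y"
    have "(v - (1 / \<gamma>) *\<^sub>R (w - x)) \<bullet> (y - x) = - ((x - (w - \<gamma> *\<^sub>R v)) \<bullet> (x - y)) / \<gamma>"
      using g by (simp add: field_simps inner_diff_left inner_diff_right inner_add_left)
    then show "(v - (1 / \<gamma>) *\<^sub>R (w - x)) \<bullet> (y - x) \<ge> 0"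
      using x[OF \<open>v \<in> T y\<close>] g by (simp add: divide_nonpos_pos)
  qed
  have "resolvent \<gamma> T w = x"
    using resolvent_eqI[OF mono g mem] g by simp
  with mem show ?thesis by simp
qed

section \<open>The Douglas--Rachford residual\<close>

text \<open>The graph points encode x = J_{\<gamma>B} u and v = J_{\<gamma>A}(2x - u). Monotonicity
  of \<open>B\<close> and of \<open>A\<close>, written in the differences \<open>p\<close>,
  \<open>q\<close>, \<open>r\<close>, add up exactly to firm nonexpansiveness of u -> x - v; scaling
  by 1/\<gamma> gives cocoercivity.\<close>

lemma douglas_rachford_cocoercive:
  assumes "monotone_op A" "monotone_op B" and g: "\<gamma> > 0"
    and "(1 / \<gamma>) *\<^sub>R (u - x) \<in> B x" "(1 / \<gamma>) *\<^sub>R (2 *\<^sub>R x - u - v) \<in> A v"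
    and "(1 / \<gamma>) *\<^sub>R (u' - x') \<in> B x'" "(1 / \<gamma>) *\<^sub>R (2 *\<^sub>R x' - u' - v') \<in> A v'"
  shows "((1 / \<gamma>) *\<^sub>R (x - v) - (1 / \<gamma>) *\<^sub>R (x' - v')) \<bullet> (u - u')
    \<ge> \<gamma> * (norm ((1 / \<gamma>) *\<^sub>R (x - v) - (1 / \<gamma>) *\<^sub>R (x' - v')))\<^sup>2"
proof -
  define p q r where "p = x - x'" and "q = v - v'" and "r = u - u'"
  have "((1 / \<gamma>) *\<^sub>R (u - x) - (1 / \<gamma>) *\<^sub>R (u' - x')) \<bullet> p \<ge> 0"
    using assms unfolding monotone_op_def p_def by blast
  moreover have "(1 / \<gamma>) *\<^sub>R (u - x) - (1 / \<gamma>) *\<^sub>R (u' - x') = (1 / \<gamma>) *\<^sub>R (r - p)"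
    by (simp add: p_def r_def algebra_simps)
  ultimately have 1: "(r - p) \<bullet> p \<ge> 0"
    using g by (simp add: zero_le_divide_iff)
  have "((1 / \<gamma>) *\<^sub>R (2 *\<^sub>R x - u - v) - (1 / \<gamma>) *\<^sub>R (2 *\<^sub>R x' - u' - v')) \<bullet> q \<ge> 0"
    using assms unfolding monotone_op_def q_def by blast
  moreover have "(1 / \<gamma>) *\<^sub>R (2 *\<^sub>R x - u - v) - (1 / \<gamma>) *\<^sub>R (2 *\<^sub>R x' - u' - v')
      = (1 / \<gamma>) *\<^sub>R (2 *\<^sub>R p - r - q)"
    by (simp add: p_def q_def r_def algebra_simps)
  ultimately have 2: "(2 *\<^sub>R p - r - q) \<bullet> q \<ge> 0"
    using g by (simp add: zero_le_divide_iff)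
  have "(p - q) \<bullet> r - (norm (p - q))\<^sup>2 = (r - p) \<bullet> p + (2 *\<^sub>R p - r - q) \<bullet> q"
    by (simp add: power2_norm_eq_inner algebra_simps inner_commute)
  with 1 2 have "(norm (p - q))\<^sup>2 \<le> (p - q) \<bullet> r" by linarith
  then have "(norm (p - q))\<^sup>2 / \<gamma> \<le> (p - q) \<bullet> r / \<gamma>"
    using g by (simp add: divide_right_mono)
  moreover have "(1 / \<gamma>) *\<^sub>R (x - v) - (1 / \<gamma>) *\<^sub>R (x' - v') = (1 / \<gamma>) *\<^sub>R (p - q)"
    by (simp add: p_def q_def algebra_simps)
  ultimately show ?thesis
    using g by (simp add: r_def power2_eq_square power_divide)
qed

section \<open>The Halpern iteration\<close>

text \<open>One iteration with n = k + 1: \<open>F\<close>, \<open>G\<close> are the residuals at k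
  and k + 1, and \<open>d\<close>, \<open>e\<close> the offsets of the two iterates from the anchor
  u_0.\<close>

lemma halpern_potential_decrease:
  fixes F G d e :: "'a::real_inner" and n \<gamma> \<eta> \<eta>' :: real
  assumes n: "n > 0" and eta: "\<eta> < 2 * \<gamma>"
    and step: "\<eta>' * ((n + 2) * n * (2 * \<gamma> - \<eta>)) = \<eta> * (2 * \<gamma> * n * (n + 2) - \<eta> * (n + 1)\<^sup>2)"
    and e: "e = (n / (n + 1)) *\<^sub>R d - \<eta> *\<^sub>R F"
    and coco: "(G - F) \<bullet> (e - d) \<ge> \<gamma> * (norm (G - F))\<^sup>2"
  shows "(n + 1) * (n + 2) * \<eta>' / 2 * (norm G)\<^sup>2 + (n + 1) * (G \<bullet> e)
    \<le> n * (n + 1) * \<eta> / 2 * (norm F)\<^sup>2 + n * (F \<bullet> d)"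
proof -
  define H X Y Z P Q where "H = 2 * \<gamma> - \<eta>" and "X = F \<bullet> F" and "Y = G \<bullet> G" and "Z = F \<bullet> G"
    and "P = F \<bullet> d" and "Q = G \<bullet> d"
  have H: "H > 0" using eta by (simp add: H_def)
  \<comment> \<open>\<open>D\<close> is the drop of the potential minus n(n + 1) times the slack in
    cocoercivity; this multiplier cancels all terms in \<open>d\<close>.\<close>
  define D where "D = n * (n + 1) * (\<gamma> * (Y - 2 * Z + X) + \<eta> * (Z - X) + \<eta> * X / 2)
    + (n + 1) * \<eta> * Z - (n + 1) * (n + 2) * \<eta>' / 2 * Y"
  have "e - d = (n / (n + 1) - 1) *\<^sub>R d - \<eta> *\<^sub>R F"
    by (simp add: e algebra_simps)
  moreover have "n / (n + 1) - 1 = - (1 / (n + 1))"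
    using n by (simp add: field_simps)
  ultimately have ed: "e - d = - (1 / (n + 1)) *\<^sub>R d - \<eta> *\<^sub>R F"
    by simp
  have "(G - F) \<bullet> (e - d) = (P - Q) / (n + 1) - \<eta> * (Z - X)"
    unfolding ed
    by (simp add: P_def Q_def Z_def X_def inner_diff_left inner_diff_right inner_commute
        diff_divide_distrib algebra_simps)
  moreover have "(norm (G - F))\<^sup>2 = Y - 2 * Z + X"
    by (simp add: power2_norm_eq_inner X_def Y_def Z_def algebra_simps inner_commute)
  ultimately have "\<gamma> * (Y - 2 * Z + X) + \<eta> * (Z - X) \<le> (P - Q) / (n + 1)"
    using coco by simp
  then have "n * (n + 1) * (\<gamma> * (Y - 2 * Z + X) + \<eta> * (Z - X))
      \<le> n * (n + 1) * ((P - Q) / (n + 1))"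
    using n by (intro mult_left_mono) auto
  then have PQ: "n * (n + 1) * (\<gamma> * (Y - 2 * Z + X) + \<eta> * (Z - X)) \<le> n * (P - Q)"
    using n by simp
  have "G \<bullet> e = n / (n + 1) * Q - \<eta> * Z"
    unfolding e by (simp add: Q_def Z_def inner_diff_right inner_commute)
  then have Ge: "(n + 1) * (G \<bullet> e) = n * Q - (n + 1) * \<eta> * Z"
    using n by (simp add: field_simps)
  have "2 * n * H * D = (n + 1) * (n\<^sup>2 * H * (H * X + 2 * \<gamma> * Y - 2 * (2 * \<gamma> - \<eta>) * Z)
      + 2 * n * H * \<eta> * Z - \<eta>' * ((n + 2) * n * (2 * \<gamma> - \<eta>)) * Y)"
    unfolding D_def H_def by (simp add: field_simps power2_eq_square)
  \<comment> \<open>The stepsize rule turns the coefficient of \<open>Y\<close> into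
    \<open>(n * H - \<eta>)\<^sup>2\<close>, which completes the square.\<close>
  also have "\<dots> = (n + 1) * ((n * H)\<^sup>2 * X - 2 * (n * H) * (n * H - \<eta>) * Z + (n * H - \<eta>)\<^sup>2 * Y)"
    unfolding step H_def by (simp add: algebra_simps power2_eq_square)
  also have "\<dots> = (n + 1) * (norm ((n * H) *\<^sub>R F - (n * H - \<eta>) *\<^sub>R G))\<^sup>2"
    unfolding power2_norm_eq_inner X_def Y_def Z_def
    by (simp add: inner_diff_left inner_diff_right inner_commute power2_eq_square
        algebra_simps)
  finally have "0 \<le> 2 * n * H * D" using n by simp
  moreover have "2 * n * H > 0" using n H by simp
  ultimately have "D \<ge> 0" using zero_le_mult_iff[of "2 * n * H" D] by linarith
  moreover have "n * (n + 1) * \<eta> / 2 * X + n * P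
      - ((n + 1) * (n + 2) * \<eta>' / 2 * Y + (n * Q - (n + 1) * \<eta> * Z))
    = D + (n * (P - Q) - n * (n + 1) * (\<gamma> * (Y - 2 * Z + X) + \<eta> * (Z - X)))"
    unfolding D_def by (simp add: field_simps)
  ultimately show ?thesis
    using PQ unfolding Ge power2_norm_eq_inner X_def[symmetric] Y_def[symmetric] P_def[symmetric]
    by linarith
qed

section \<open>The stepsizes and their limit\<close>

lemma halpern_stepsize_rewrite:
  fixes \<beta> \<beta>' \<gamma> \<eta> \<eta>' :: real
  assumes "\<beta> = 1 / (real k + 2)" "\<beta>' = 1 / (real (Suc k) + 2)"
    and "\<eta>' = \<beta>' * (2 * \<gamma> * (1 - \<beta>\<^sup>2) - \<eta>) * \<eta> / (\<beta> * (1 - \<beta>) * (2 * \<gamma> - \<eta>))"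
    and "\<eta> < 2 * \<gamma>"
  shows "\<eta>' = \<eta> - \<eta>\<^sup>2 / (2 * \<gamma> - \<eta>) / ((real k + 1) * (real k + 3))"
proof -
  define n where "n = real k + 1"
  have n: "n > 0" "real k = n - 1" "real (Suc k) = n" by (auto simp: n_def)
  define H where "H = 2 * \<gamma> - \<eta>"
  have H: "H > 0" "2 * \<gamma> = H + \<eta>" using assms by (auto simp: H_def)
  have b: "\<beta> = 1 / (n + 1)" "\<beta>' = 1 / (n + 2)" using assms(1,2) n by auto
  have b1: "1 - \<beta> = n / (n + 1)" "1 - \<beta>\<^sup>2 = n * (n + 2) / (n + 1)\<^sup>2"
    using n unfolding b
    by (simp_all add: power_divide divide_simps) (simp add: algebra_simps power2_eq_square)
  have "\<eta>' = 1 / (n + 2) * ((H + \<eta>) * (n * (n + 2) / (n + 1)\<^sup>2) - \<eta>) * \<eta>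
      / (1 / (n + 1) * (n / (n + 1)) * H)"
    unfolding assms(3) b1 H_def[symmetric] unfolding H(2) b ..
  \<comment> \<open>The factor 1 / (1 - \<beta>^2) exceeds 1 by 1/(n(n + 2)), and this excess
    produces the decrement.\<close>
  also have "\<dots> = \<eta> - \<eta>\<^sup>2 / H / (n * (n + 2))"
    using n H by (simp add: divide_simps power2_eq_square) (simp add: algebra_simps)
  finally show ?thesis by (simp add: H_def n_def add.commute)
qed

text \<open>The decrements are nonnegative and sum to at most 3/4 of \<open>D\<close>. The recursion
  is assumed only below 2\<gamma>, since that bound is itself obtained along the induction.\<close>

lemma halpern_stepsize_limit:
  fixes \<gamma> :: real and \<eta> :: "nat \<Rightarrow> real"
  assumes e0: "0 < \<eta> 0" "\<eta> 0 < \<gamma>"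
    and step: "\<And>k. \<eta> k < 2 * \<gamma> \<Longrightarrow>
      \<eta> (Suc k) = \<eta> k - (\<eta> k)\<^sup>2 / (2 * \<gamma> - \<eta> k) / ((real k + 1) * (real k + 3))"
  obtains l where "\<eta> \<longlonglongrightarrow> l" "\<And>k. l \<le> \<eta> k" "\<And>k. \<eta> k \<le> \<eta> 0"
    "l > 2 * \<eta> 0 * (\<gamma> - \<eta> 0) / (2 * \<gamma> - \<eta> 0)"
proof -
  define D where "D = (\<eta> 0)\<^sup>2 / (2 * \<gamma> - \<eta> 0)"
  have D: "D > 0" using e0 by (simp add: D_def)
  have lim_eq: "\<eta> 0 - D = 2 * \<eta> 0 * (\<gamma> - \<eta> 0) / (2 * \<gamma> - \<eta> 0)"
    using e0 by (simp add: D_def field_simps power2_eq_square)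
  have pos: "\<eta> 0 - D > 0" unfolding lim_eq using e0 by simp
  \<comment> \<open>\<open>3/4 - 1/(2(k+1)) - 1/(2(k+2))\<close> is the partial sum of \<open>1/((j+1)(j+3))\<close> over \<open>j < k\<close>\<close>
  have inv: "\<eta> k \<le> \<eta> 0 \<and>
      \<eta> 0 - D * (3/4 - 1 / (2 * (real k + 1)) - 1 / (2 * (real k + 2))) \<le> \<eta> k \<and> 0 < \<eta> k \<and>
      \<eta> (Suc k) \<le> \<eta> k" for k
  proof (induction k)
    \<comment> \<open>The function t^2/(2\<gamma> - t) increases on (0, \<gamma>), so its value
      \<open>D\<close> at \<open>\<eta> 0\<close> dominates all later ones.\<close>
    have dec: "\<eta> (Suc k) \<le> \<eta> k \<and> \<eta> k - D * (1 / ((real k + 1) * (real k + 3))) \<le> \<eta> (Suc k)"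
      if le: "\<eta> k \<le> \<eta> 0" and p: "0 < \<eta> k" for k
    proof -
      have "(\<eta> k)\<^sup>2 / (2 * \<gamma> - \<eta> k) \<le> D"
        unfolding D_def using le p e0 by (intro frac_le power_mono) auto
      then have "(\<eta> k)\<^sup>2 / (2 * \<gamma> - \<eta> k) * (1 / ((real k + 1) * (real k + 3)))
          \<le> D * (1 / ((real k + 1) * (real k + 3)))"
        by (intro mult_right_mono) auto
      moreover have "0 \<le> (\<eta> k)\<^sup>2 / (2 * \<gamma> - \<eta> k) * (1 / ((real k + 1) * (real k + 3)))"
        using le e0 by (intro mult_nonneg_nonneg divide_nonneg_nonneg) auto
      ultimately show ?thesis
        using step[of k] le e0 by auto
    qed
    case 0
    show ?case using dec[of 0] e0 by simp
    case (Suc k)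
    then have d: "\<eta> (Suc k) \<le> \<eta> k" "\<eta> k - D * (1 / ((real k + 1) * (real k + 3))) \<le> \<eta> (Suc k)"
      using dec[of k] by auto
    have "3/4 - 1 / (2 * (real k + 1)) - 1 / (2 * (real k + 2)) + 1 / ((real k + 1) * (real k + 3))
        = 3/4 - 1 / (2 * (real (Suc k) + 1)) - 1 / (2 * (real (Suc k) + 2))"
      by (simp add: divide_simps) (simp add: algebra_simps)
    then have "D * (3/4 - 1 / (2 * (real k + 1)) - 1 / (2 * (real k + 2)))
        + D * (1 / ((real k + 1) * (real k + 3)))
        = D * (3/4 - 1 / (2 * (real (Suc k) + 1)) - 1 / (2 * (real (Suc k) + 2)))"
      by (metis distrib_left)
    with d Suc have low:
      "\<eta> 0 - D * (3/4 - 1 / (2 * (real (Suc k) + 1)) - 1 / (2 * (real (Suc k) + 2))) \<le> \<eta> (Suc k)"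
      by linarith
    have "D * (3/4 - 1 / (2 * (real (Suc k) + 1)) - 1 / (2 * (real (Suc k) + 2))) \<le> D * 1"
    proof (intro mult_left_mono)
      have "0 \<le> 1 / (2 * (real (Suc k) + 1))" "0 \<le> 1 / (2 * (real (Suc k) + 2))" by simp_all
      then show "3/4 - 1 / (2 * (real (Suc k) + 1)) - 1 / (2 * (real (Suc k) + 2)) \<le> 1"
        by linarith
    qed (use D in simp)
    with low pos have "0 < \<eta> (Suc k)" by linarith
    with low d Suc dec[of "Suc k"] show ?case by linarith
  qed
  have low: "\<eta> 0 - D * (3/4) \<le> \<eta> k" for k
  proof -
    have "D * (3/4 - 1 / (2 * (real k + 1)) - 1 / (2 * (real k + 2))) \<le> D * (3/4)"
    proof (intro mult_left_mono)
      have "0 \<le> 1 / (2 * (real k + 1))" "0 \<le> 1 / (2 * (real k + 2))" by simp_all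
      then show "3/4 - 1 / (2 * (real k + 1)) - 1 / (2 * (real k + 2)) \<le> 3/4"
        by linarith
    qed (use D in simp)
    with inv[of k] show ?thesis by linarith
  qed
  obtain l where l: "\<eta> \<longlonglongrightarrow> l" "\<And>k. l \<le> \<eta> k"
    using decseq_convergent[of \<eta>] low inv by (metis decseq_SucI)
  have "\<eta> 0 - D * (3/4) \<le> l"
    using LIMSEQ_le_const[OF l(1)] low by blast
  \<comment> \<open>The margin between 3/4 and 1 makes the bound strict.\<close>
  then have "l > \<eta> 0 - D" using D by linarith
  then show thesis using that l inv unfolding lim_eq by blast
qed

text \<open>The potential stays below its initial value. Bounding it from below by
  \<open>sol\<close> and Cauchy-Schwarz leaves a quadratic inequality for the residual norm.\<close>

lemma halpern_rate:
  fixes u F :: "nat \<Rightarrow> 'a::real_inner" and z :: 'a and \<gamma> l :: real and \<eta> :: "nat \<Rightarrow> real"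
  assumes step: "\<And>k. \<eta> (Suc k) = \<eta> k - (\<eta> k)\<^sup>2 / (2 * \<gamma> - \<eta> k) / ((real k + 1) * (real k + 3))"
    and \<eta>: "\<And>k. l \<le> \<eta> k" "\<And>k. \<eta> k < 2 * \<gamma>" and l: "l > 0" and g: "\<gamma> > 0"
    and u: "\<And>k. u (Suc k) = u k + (1 / (real k + 2)) *\<^sub>R (u 0 - u k) - \<eta> k *\<^sub>R F k"
    and coco: "\<And>i j. (F i - F j) \<bullet> (u i - u j) \<ge> \<gamma> * (norm (F i - F j))\<^sup>2"
    and sol: "\<And>i. F i \<bullet> (u i - z) \<ge> \<gamma> * (norm (F i))\<^sup>2"
  shows "(norm (F k))\<^sup>2 \<le> 4 / (l * (real k + 1) * (real k + 2))
    * (\<eta> 0 * (norm (F 0))\<^sup>2 + 1 / l * (norm (z - u 0))\<^sup>2)"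
proof -
  define V where "V k = (real k + 1) * (real k + 2) * \<eta> k / 2 * (norm (F k))\<^sup>2
    + (real k + 1) * (F k \<bullet> (u k - u 0))" for k
  have "V (Suc k) \<le> V k" for k
  proof -
    define n where "n = real k + 1"
    have n: "n > 0" by (simp add: n_def)
    have "\<eta> (Suc k) = \<eta> k - (\<eta> k)\<^sup>2 / (2 * \<gamma> - \<eta> k) / (n * (n + 2))"
      using step[of k] by (simp add: n_def add.commute)
    then have st: "\<eta> (Suc k) * ((n + 2) * n * (2 * \<gamma> - \<eta> k))
        = \<eta> k * (2 * \<gamma> * n * (n + 2) - \<eta> k * (n + 1)\<^sup>2)"
      using n \<eta>(2)[of k] by (simp add: divide_simps) (simp add: algebra_simps power2_eq_square)
    have "n / (n + 1) = 1 - 1 / (n + 1)" using n by (simp add: field_simps)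
    moreover have "real k + 2 = n + 1" by (simp add: n_def)
    ultimately have "u (Suc k) - u 0 = (n / (n + 1)) *\<^sub>R (u k - u 0) - \<eta> k *\<^sub>R F k"
      unfolding u[of k] by (simp only:) (simp add: algebra_simps)
    from halpern_potential_decrease[OF n \<eta>(2) st this, of "F (Suc k)"] coco[of "Suc k" k]
    show ?thesis by (simp add: V_def n_def algebra_simps)
  qed
  then have "V k \<le> V 0" by (rule lift_Suc_antimono_le) simp
  \<comment> \<open>The inner product in \<open>V 0\<close> vanishes because the anchor is the
    starting point.\<close>
  then have Vk: "V k \<le> \<eta> 0 * (norm (F 0))\<^sup>2" by (simp add: V_def)
  define n w X where "n = real k + 1" and "w = norm (z - u 0)" and "X = norm (F k)"
  have n: "n > 0" by (simp add: n_def)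
  have V: "V k = n * (n + 1) * \<eta> k / 2 * X\<^sup>2 + n * (F k \<bullet> (u k - u 0))"
    by (simp add: V_def n_def X_def add.commute)
  have "F k \<bullet> (u k - u 0) = F k \<bullet> (u k - z) + F k \<bullet> (z - u 0)"
    by (simp add: inner_diff_right)
  moreover have "F k \<bullet> (u k - z) \<ge> 0"
    using sol[of k] g by (smt (verit) mult_nonneg_nonneg zero_le_power2)
  moreover have "F k \<bullet> (z - u 0) \<ge> - (X * w)"
    using Cauchy_Schwarz_ineq2[of "F k" "z - u 0"] by (simp add: w_def X_def)
  ultimately have "n * (F k \<bullet> (u k - u 0)) \<ge> - (n * (X * w))"
    using n mult_left_mono[of "- (X * w)" "F k \<bullet> (u k - u 0)" n] by simp
  moreover have "n * (n + 1) * l / 2 * X\<^sup>2 \<le> n * (n + 1) * \<eta> k / 2 * X\<^sup>2"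
    using n \<eta>(1)[of k] by (intro mult_right_mono divide_right_mono mult_left_mono) auto
  ultimately have 1: "n * (n + 1) * l / 2 * X\<^sup>2 - n * (X * w) \<le> \<eta> 0 * (norm (F 0))\<^sup>2"
    using Vk V by linarith
  have half: "n * (n + 1) * l / 2 * X\<^sup>2 = 2 * (n * (n + 1) * l / 4 * X\<^sup>2)" by simp
  \<comment> \<open>Young's inequality, weighted so that half of the quadratic term absorbs the
    cross term; the remaining half explains the constant 4.\<close>
  have "0 \<le> n * (n + 1) / l * (l * X / 2 - w / (n + 1))\<^sup>2"
    using n l by simp
  also have "\<dots> = n * (n + 1) * l / 4 * X\<^sup>2 - n * (X * w) + n / (n + 1) * (w\<^sup>2 / l)"
    using n l by (simp add: divide_simps power2_eq_square) (simp add: algebra_simps)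
  also have "n / (n + 1) * (w\<^sup>2 / l) \<le> 1 * (w\<^sup>2 / l)"
    using n l by (intro mult_right_mono) auto
  finally have "n * (n + 1) * l / 4 * X\<^sup>2 \<le> \<eta> 0 * (norm (F 0))\<^sup>2 + w\<^sup>2 / l"
    using 1 half by linarith
  then have "X\<^sup>2 \<le> (\<eta> 0 * (norm (F 0))\<^sup>2 + w\<^sup>2 / l) / (n * (n + 1) * l / 4)"
    using n l by (subst pos_le_divide_eq) (auto simp: mult.commute)
  then show ?thesis
    by (simp add: X_def w_def n_def mult.commute mult.left_commute add.commute)
qed

section \<open>Rates for the forward-backward residual\<close>

theorem theorem4:
  fixes A B :: "real ^ 'p \<Rightarrow> (real ^ 'p) set"
    and \<gamma> :: real
    and xstar :: "real ^ 'p"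
    and u x :: "nat \<Rightarrow> real ^ 'p"
    and \<beta> \<eta> :: "nat \<Rightarrow> real"
  assumes "maximally_monotone A"
    and "maximally_monotone B"
    and "single_valued_op B"
    and "\<gamma> > 0"
    and "0 \<in> A xstar + B xstar"
    and "\<And>k. \<beta> k = 1 / (real k + 2)"
    and "0 < \<eta> 0" and "\<eta> 0 < \<gamma>"
    and "\<And>k. \<eta> (Suc k) =
          \<beta> (Suc k) * (2 * \<gamma> * (1 - (\<beta> k)\<^sup>2) - \<eta> k) * \<eta> k
            / (\<beta> k * (1 - \<beta> k) * (2 * \<gamma> - \<eta> k))"
    and "x 0 = resolvent \<gamma> B (u 0)"
    and "\<And>k. u (Suc k) =
          u k + \<beta> k *\<^sub>R (u 0 - u k) - \<eta> k *\<^sub>R fb_residual \<gamma> A B (x k)"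
    and "\<And>k. x (Suc k) = resolvent \<gamma> B (u (Suc k))"
  shows "convergent \<eta> \<and>
    (let \<eta>star = lim \<eta> in
      \<eta>star > 2 * \<eta> 0 * (\<gamma> - \<eta> 0) / (2 * \<gamma> - \<eta> 0) \<and>
      2 * \<eta> 0 * (\<gamma> - \<eta> 0) / (2 * \<gamma> - \<eta> 0) > 0 \<and>
      (\<forall>k. (norm (fb_residual \<gamma> A B (x k)))\<^sup>2
          \<le> 4 / (\<eta>star * (real k + 1) * (real k + 2))
             * (\<eta> 0 * (norm (fb_residual \<gamma> A B (x 0)))\<^sup>2
                + 1 / \<eta>star * (norm (xstar + \<gamma> *\<^sub>R op_val B xstar - u 0))\<^sup>2)) \<and>
      (\<forall>L. L-lipschitz_on (op_dom B) (op_val B) \<longrightarrow>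
        (\<forall>k. (norm (fb_residual \<gamma> A B (x k)))\<^sup>2
          \<le> 4 * (1 + \<gamma> * L)\<^sup>2 * (\<eta> 0 * \<eta>star + \<gamma>\<^sup>2)
               / (\<eta>star\<^sup>2 * \<gamma>\<^sup>2 * (real k + 1) * (real k + 2))
             * (norm (x 0 - xstar))\<^sup>2)))"
proof -
  note A = assms(1) and B = assms(2) and g = assms(4)
  have mA: "monotone_op A" and mB: "monotone_op B"
    using A B by (auto simp: maximally_monotone_def)
  have val: "op_val B y = v" if "v \<in> B y" for y v
  proof -
    have "B y = {v}"
      using that assms(3) unfolding single_valued_op_def by blast
    then show ?thesis by (simp add: op_val_def)
  qed
  have x: "x k = resolvent \<gamma> B (u k)" for k
    using assms(10,12) by (cases k) auto
  have xB: "(1 / \<gamma>) *\<^sub>R (u k - x k) \<in> B (x k)" for k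
    unfolding x by (rule minty[OF B g])
  define v where "v k = resolvent \<gamma> A (2 *\<^sub>R x k - u k)" for k
  have vA: "(1 / \<gamma>) *\<^sub>R (2 *\<^sub>R x k - u k - v k) \<in> A (v k)" for k
    unfolding v_def by (rule minty[OF A g])
  define F where "F k = fb_residual \<gamma> A B (x k)" for k
  have F: "F k = (1 / \<gamma>) *\<^sub>R (x k - v k)" for k
  proof -
    \<comment> \<open>The forward step from \<open>x k\<close> is the reflected point, so the
      forward-backward residual is the Douglas-Rachford residual at \<open>u k\<close>.\<close>
    have "x k - \<gamma> *\<^sub>R op_val B (x k) = 2 *\<^sub>R x k - u k"
      using val[OF xB] g by (simp add: scaleR_2)
    then show ?thesis by (simp add: F_def fb_residual_def v_def)
  qed
  obtain b where bA: "- b \<in> A xstar" and bB: "b \<in> B xstar"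
    using assms(5) by (auto simp: set_plus_def eq_neg_iff_add_eq_0[symmetric])
  \<comment> \<open>At \<open>z\<close> the \<open>B\<close>-resolvent and then the reflected
    \<open>A\<close>-resolvent both return \<open>xstar\<close>, so the residual vanishes
    there.\<close>
  define z where "z = xstar + \<gamma> *\<^sub>R op_val B xstar"
  have z: "(1 / \<gamma>) *\<^sub>R (z - xstar) \<in> B xstar" "(1 / \<gamma>) *\<^sub>R (2 *\<^sub>R xstar - z - xstar) \<in> A xstar"
    using bA bB val[OF bB] g by (simp_all add: z_def scaleR_2)
  have coco: "(F i - F j) \<bullet> (u i - u j) \<ge> \<gamma> * (norm (F i - F j))\<^sup>2" for i j
    unfolding F by (rule douglas_rachford_cocoercive[OF mA mB g xB vA xB vA])
  have sol: "F i \<bullet> (u i - z) \<ge> \<gamma> * (norm (F i))\<^sup>2" for i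
    using douglas_rachford_cocoercive[OF mA mB g xB[of i] vA[of i] z] unfolding F by simp
  have step: "\<eta> (Suc k) = \<eta> k - (\<eta> k)\<^sup>2 / (2 * \<gamma> - \<eta> k) / ((real k + 1) * (real k + 3))"
    if "\<eta> k < 2 * \<gamma>" for k
    by (rule halpern_stepsize_rewrite[OF assms(6) assms(6) assms(9) that])
  obtain l where l: "\<eta> \<longlonglongrightarrow> l" "\<And>k. l \<le> \<eta> k" "\<And>k. \<eta> k \<le> \<eta> 0"
    "l > 2 * \<eta> 0 * (\<gamma> - \<eta> 0) / (2 * \<gamma> - \<eta> 0)"
    using halpern_stepsize_limit[OF assms(7,8) step] by blast
  have pos: "2 * \<eta> 0 * (\<gamma> - \<eta> 0) / (2 * \<gamma> - \<eta> 0) > 0"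
    using assms(7,8) by simp
  have l0: "l > 0" using l(4) pos by linarith
  have lt: "\<eta> k < 2 * \<gamma>" for k
    using l(3)[of k] assms(7,8) by linarith
  have rate: "(norm (F k))\<^sup>2 \<le> 4 / (l * (real k + 1) * (real k + 2))
    * (\<eta> 0 * (norm (F 0))\<^sup>2 + 1 / l * (norm (z - u 0))\<^sup>2)" for k
  proof (rule halpern_rate[OF step[OF lt] l(2) lt l0 g _ coco sol])
    show "u (Suc k) = u k + (1 / (real k + 2)) *\<^sub>R (u 0 - u k) - \<eta> k *\<^sub>R F k" for k
      using assms(11)[of k] unfolding assms(6) F_def .
  qed
  have lip: "(norm (F k))\<^sup>2 \<le> 4 * (1 + \<gamma> * L)\<^sup>2 * (\<eta> 0 * l + \<gamma>\<^sup>2)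
      / (l\<^sup>2 * \<gamma>\<^sup>2 * (real k + 1) * (real k + 2)) * (norm (x 0 - xstar))\<^sup>2"
    if L: "L-lipschitz_on (op_dom B) (op_val B)" for L k
  proof -
    define w where "w = norm (z - u 0)"
    have "u 0 = x 0 + \<gamma> *\<^sub>R op_val B (x 0)"
      using val[OF xB] g by simp
    then have "z - u 0 = (xstar - x 0) + \<gamma> *\<^sub>R (op_val B xstar - op_val B (x 0))"
      by (simp add: z_def algebra_simps)
    then have "w \<le> norm (xstar - x 0) + \<gamma> * norm (op_val B xstar - op_val B (x 0))"
      using g norm_triangle_ineq[of "xstar - x 0" "\<gamma> *\<^sub>R (op_val B xstar - op_val B (x 0))"]
      by (simp add: w_def)
    \<comment> \<open>Both points lie in \<open>op_dom B\<close>: \<open>xstar\<close> through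
      \<open>b\<close>, and \<open>x 0\<close> as a resolvent value.\<close>
    also have "norm (op_val B xstar - op_val B (x 0)) \<le> L * norm (xstar - x 0)"
      using lipschitz_onD[OF L, of xstar "x 0"] bB xB[of 0] by (auto simp: op_dom_def dist_norm)
    finally have "w \<le> (1 + \<gamma> * L) * norm (x 0 - xstar)"
      using g by (simp add: algebra_simps norm_minus_commute)
    then have w: "w\<^sup>2 \<le> (1 + \<gamma> * L)\<^sup>2 * (norm (x 0 - xstar))\<^sup>2"
      unfolding power_mult_distrib[symmetric] by (intro power_mono) (auto simp: w_def)
    \<comment> \<open>Cocoercivity against \<open>z\<close> bounds the initial residual by
      w/\<gamma>, so both terms of the rate become multiples of \<open>w\<^sup>2\<close>.\<close>
    have "\<gamma> * (norm (F 0))\<^sup>2 \<le> norm (F 0) * w"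
      using sol[of 0] norm_cauchy_schwarz[of "F 0" "u 0 - z"]
      by (simp add: w_def norm_minus_commute)
    then have "\<gamma> * norm (F 0) \<le> w"
      by (cases "norm (F 0) = 0") (auto simp: power2_eq_square w_def)
    then have "(\<gamma> * norm (F 0))\<^sup>2 \<le> w\<^sup>2"
      using g by (intro power_mono) auto
    then have "(norm (F 0))\<^sup>2 \<le> w\<^sup>2 / \<gamma>\<^sup>2"
      using g by (simp add: field_simps)
    then have "\<eta> 0 * (norm (F 0))\<^sup>2 + 1 / l * w\<^sup>2 \<le> \<eta> 0 * (w\<^sup>2 / \<gamma>\<^sup>2) + 1 / l * w\<^sup>2"
      using assms(7) by (intro add_right_mono mult_left_mono) auto
    also have "\<dots> = (\<eta> 0 * l + \<gamma>\<^sup>2) / (l * \<gamma>\<^sup>2) * w\<^sup>2"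
      using l0 g by (simp add: field_simps)
    also have "\<dots> \<le> (\<eta> 0 * l + \<gamma>\<^sup>2) / (l * \<gamma>\<^sup>2) * ((1 + \<gamma> * L)\<^sup>2 * (norm (x 0 - xstar))\<^sup>2)"
      using w assms(7) l0 by (intro mult_left_mono) auto
    finally have "4 / (l * (real k + 1) * (real k + 2)) * (\<eta> 0 * (norm (F 0))\<^sup>2 + 1 / l * w\<^sup>2)
      \<le> 4 / (l * (real k + 1) * (real k + 2))
        * ((\<eta> 0 * l + \<gamma>\<^sup>2) / (l * \<gamma>\<^sup>2) * ((1 + \<gamma> * L)\<^sup>2 * (norm (x 0 - xstar))\<^sup>2))"
      using l0 by (intro mult_left_mono) auto
    also have "\<dots> = 4 * (1 + \<gamma> * L)\<^sup>2 * (\<eta> 0 * l + \<gamma>\<^sup>2)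
      / (l\<^sup>2 * \<gamma>\<^sup>2 * (real k + 1) * (real k + 2)) * (norm (x 0 - xstar))\<^sup>2"
      by (simp add: power2_eq_square mult.commute mult.left_commute)
    finally show ?thesis using rate[of k] unfolding w_def by linarith
  qed
  show ?thesis
    using l pos rate lip
    unfolding limI[OF l(1)] Let_def F_def z_def
    by (auto simp: convergent_def)
qed

end
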